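(* Let $\mathrm{V}$ be a finite vertex set, let $\mathfrak{G}$ be the class of all directed acyclic graphs (DAGs) over $\mathrm{V}$, and let $\mathcal{L}=(\mathfrak{G},\preceq)$ be the poset with $\mathcal{D}_1\preceq\mathcal{D}_2$ if and only if $\mathcal{M}^{\mathrm{c}}_{\mathrm{DAG}}(\mathcal{D}_1)\subseteq\mathcal{M}^{\mathrm{c}}_{\mathrm{DAG}}(\mathcal{D}_2)$. For all $\mathcal{D}_1=(\mathrm{V},\mathrm{E}_1),\mathcal{D}_2=(\mathrm{V},\mathrm{E}_2)\in\mathfrak{G}$, $$d_{\mathcal{L}}(\mathcal{D}_1,\mathcal{D}_2)=|\mathrm{E}_1\triangle\mathrm{E}_2|=\mathrm{SHD}_2(\mathcal{D}_1,\mathcal{D}_2).$$ Further, $d_{\mathcal{L}}(\mathcal{D}_1,\mathcal{D}_2)\ge\mathrm{SHD}_1(\mathcal{D}_1,\mathcal{D}_2)$, and whenever $\mathcal{D}_1$ and $\mathcal{D}_2$ have at least one edge in opposite directions, $d_{\mathcal{L}}(\mathcal{D}_1,\mathcal{D}_2)>\mathrm{SHD}_1(\mathcal{D}_1,\mathcal{D}_2)$.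
   Context: Causal model. For each $v\in\mathrm{V}$ let $\mathcal{X}_v$ be a state space, infinite or finite with at least two elements; $\mathcal{X}_{\mathrm{I}}=\prod_{v\in\mathrm{I}}\mathcal{X}_v$ for $\mathrm{I}\subseteq\mathrm{V}$, and $\mathcal{X}=\mathcal{X}_{\mathrm{V}}$ is equipped with a suitable product $\sigma$-algebra. The potential outcome schedule is the stochastic process $X(\cdot)=(X_v(x_{\mathrm{I}}):v\in\mathrm{V},\mathrm{I}\subseteq\mathrm{V},x_{\mathrm{I}}\in\mathcal{X}_{\mathrm{I}})$, where the $\mathcal{X}_v$-valued $X_v(x_{\mathrm{I}})$ is the potential outcome of variable $v$ under the intervention imposing $x_{\mathrm{I}}$ on $X_{\mathrm{I}}$. The space in which $X(\cdot)$ takes values is assumed to carry a suitable $\sigma$-algebra; $P$ denotes the law of $X(\cdot)$ and is assumed to admit the regular conditional probability distributions used below. Write $X_{\mathrm{J}}(x_{\mathrm{I}})=(X_v(x_{\mathrm{I}}))_{v\in\mathrm{J}}$ and $X(x_{\mathrm{I}})=X_{\mathrm{V}}(x_{\mathrm{I}})$. The ground causal model $\mathcal{M}^{\mathrm{c}}$ is the set of laws $P$ satisfying consistency: for all disjoint $\mathrm{I},\mathrm{I}'\subseteq\mathrm{V}$ and each $x\in\mathcal{X}$, $P\big(X(x_{\mathrm{I}},x_{\mathrm{I}'})=X(x_{\mathrm{I}})\mid X_{\mathrm{I}'}(x_{\mathrm{I}})=x_{\mathrm{I}'}\big)=1$. For a DAG $\mathcal{D}$ with parent sets $\mathrm{Pa}(v)=\{w:w\to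 v\}$, $\mathcal{M}^{\mathrm{c}}_{\mathrm{DAG}}(\mathcal{D})$ is the set of $P\in\mathcal{M}^{\mathrm{c}}$ such that: (i) for every $v\in\mathrm{V}$, $\mathrm{I}\subseteq\mathrm{V}$ and $x\in\mathcal{X}$, $P\big\{X_v(x_{\mathrm{I}})=X_v\big(x_{\mathrm{Pa}(v)\cap\mathrm{I}},X_{\mathrm{Pa}(v)\setminus\mathrm{I}}(x_{\mathrm{I}})\big)\big\}=1$; (iii) for every $x\in\mathcal{X}$, the variables $(X_v(x_{\mathrm{Pa}(v)}):v\in\mathrm{V})$ are mutually independent under $P$. Distance: $x\lessdot y$ ($y$ covers $x$) if $x\prec y$ with nothing strictly between. $d_{\mathcal{L}}(\mathcal{D}_1,\mathcal{D}_2)$ is the minimum length (number of steps) of a sequence of graphs in $\mathfrak{G}$ from $\mathcal{D}_1$ to $\mathcal{D}_2$ in which of any two consecutive graphs one covers the other. SHD: $\mathrm{E}_i$ is the set of directed edges (ordered pairs); $\triangle$ is symmetric difference. Let $A_{i,j}=1$ if $i\to j$ (or $i-j$) is in the graph and $0$ otherwise. With $A^s,A^t$ the matrices of two graphs, $\mathrm{SHD}_1=\sum_{i<j}\mathbb{I}[A^s_{i,j}\ne A^t_{i,j}\text{ or }A^s_{j,i}\ne A^t_{j,i}]$ and $\mathrm{SHD}_2=\sum_{i,j}\mathbb{I}[A^s_{i,j}\neq A^t_{i,j}]$ (sum over all ordered pairs).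
   Formalization: Laws P must also satisfy: if X_v(x_I)=X_v(x_J) a.s. for each x, then a.s. for all x at once (automatic for countable state spaces; else the claim can fail). "Suitable" σ-algebras are spelled out: measurable diagonals, and the events in (i) and in this condition. *)

theory Defs
  imports "HOL-Probability.Probability"
begin

section \<open>Potential outcome schedules\<close>

text \<open>
  An intervention imposing \<open>x\<^sub>I\<close> on \<open>I\<close> is the partial map with domain \<open>I\<close> and values \<open>x\<^sub>I\<close>;
  the combined intervention \<open>(x\<^sub>I, y\<^sub>J)\<close> with disjoint \<open>I\<close>, \<open>J\<close> is a union of maps \<open>(++)\<close>.
  A schedule \<open>s\<close> is one realisation of the process: \<open>s (v, m)\<close> is the potential outcome of \<open>v\<close>
  under \<open>m\<close>. For \<open>v \<in> dom m\<close> this is the value that \<open>v\<close> itself takes, not the imposed one.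
  The state spaces of different vertices are subsets of a common type.
\<close>

type_synonym ('v, 'a) intervention = "'v \<rightharpoonup> 'a"

type_synonym ('v, 'a) schedule = "'v \<times> ('v, 'a) intervention \<Rightarrow> 'a"

definition impose :: "('v \<Rightarrow> 'a) \<Rightarrow> 'v set \<Rightarrow> ('v, 'a) intervention" where
  "impose x I = (\<lambda>i. if i \<in> I then Some (x i) else None)"

definition interventions :: "'v set \<Rightarrow> ('v \<Rightarrow> 'a measure) \<Rightarrow> ('v, 'a) intervention set" where
  "interventions V S = {impose x I |x I. I \<subseteq> V \<and> x \<in> space (PiM I S)}"

definition cylinder_space :: "'v set \<Rightarrow> ('v \<Rightarrow> 'a measure) \<Rightarrow> ('v, 'a) schedule measure" where
  "cylinder_space V S = PiM (V \<times> interventions V S) (\<lambda>(v, m). S v)"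

text \<open>
  The intervention \<open>(x\<^bsub>K \<inter> I\<^esub>, X\<^bsub>K - I\<^esub>(x\<^sub>I))\<close> on \<open>K\<close>, where \<open>X\<^bsub>K - I\<^esub>(x\<^sub>I)\<close> is read off the
  schedule \<open>s\<close>.
\<close>

definition substitute ::
  "('v, 'a) schedule \<Rightarrow> ('v \<Rightarrow> 'a) \<Rightarrow> 'v set \<Rightarrow> 'v set \<Rightarrow> ('v, 'a) intervention" where
  "substitute s x I K = impose x (K \<inter> I) ++ impose (\<lambda>w. s (w, impose x I)) (K - I)"

text \<open>
  With uncountable state spaces the cylinder sigma-algebra does not contain the events that involve
  random or uncountably many interventions, so the schedule space \<open>\<Omega>\<close> may carry any larger
  sigma-algebra containing them.
\<close>

definition suitable_sigma_algebras ::
  "'v set \<Rightarrow> ('v \<Rightarrow> 'a measure) \<Rightarrow> ('v, 'a) schedule measure \<Rightarrow> bool" where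
  "suitable_sigma_algebras V S \<Omega> \<longleftrightarrow>
     (\<forall>v\<in>V. {p \<in> space (S v \<Otimes>\<^sub>M S v). fst p = snd p} \<in> sets (S v \<Otimes>\<^sub>M S v)) \<and>
     space \<Omega> = space (cylinder_space V S) \<and>
     sets (cylinder_space V S) \<subseteq> sets \<Omega> \<and>
     (\<forall>v\<in>V. \<forall>I K x. I \<subseteq> V \<longrightarrow> K \<subseteq> V \<longrightarrow> x \<in> space (PiM V S) \<longrightarrow>
        {s \<in> space \<Omega>. s (v, impose x I) = s (v, substitute s x I K)} \<in> sets \<Omega>) \<and>
     (\<forall>v\<in>V. \<forall>I J. I \<subseteq> V \<longrightarrow> J \<subseteq> V \<longrightarrow>
        {s \<in> space \<Omega>. \<forall>x\<in>space (PiM V S). s (v, impose x I) = s (v, impose x J)} \<in> sets \<Omega>)"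


section \<open>Causal models\<close>

text \<open>
  \<open>\<kappa>\<close> is a regular conditional probability of \<open>P\<close> given the \<open>N\<close>-valued random variable \<open>Y\<close>, i.e.
  \<open>\<kappa> y A\<close> is a version of \<open>P (A | Y = y)\<close>.
\<close>

definition regular_conditional_prob ::
  "'s measure \<Rightarrow> 'b measure \<Rightarrow> ('s \<Rightarrow> 'b) \<Rightarrow> ('b \<Rightarrow> 's measure) \<Rightarrow> bool" where
  "regular_conditional_prob P N Y \<kappa> \<longleftrightarrow>
     Y \<in> P \<rightarrow>\<^sub>M N \<and> \<kappa> \<in> N \<rightarrow>\<^sub>M prob_algebra P \<and>
     (\<forall>A\<in>sets P. \<forall>B\<in>sets N.
        emeasure P (A \<inter> (Y -` B \<inter> space P)) = (\<integral>\<^sup>+y\<in>B. emeasure (\<kappa> y) A \<partial>distr P N Y))"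

text \<open>
  If two families \<open>X\<^sub>v(x\<^sub>I)\<close> and \<open>X\<^sub>v(x\<^sub>J)\<close>, indexed by \<open>x\<close>, are modifications of each other, then they
  are indistinguishable. This is automatic for countable state spaces (see below). For uncountable
  ones it makes almost sure identities that hold at each fixed intervention usable at random ones.
\<close>

definition regular_law ::
  "'v set \<Rightarrow> ('v \<Rightarrow> 'a measure) \<Rightarrow> ('v, 'a) schedule measure \<Rightarrow> bool" where
  "regular_law V S P \<longleftrightarrow>
     (\<forall>v\<in>V. \<forall>I J. I \<subseteq> V \<longrightarrow> J \<subseteq> V \<longrightarrow>
        (\<forall>x\<in>space (PiM V S). AE s in P. s (v, impose x I) = s (v, impose x J)) \<longrightarrow>
        (AE s in P. \<forall>x\<in>space (PiM V S). s (v, impose x I) = s (v, impose x J)))"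

definition consistent ::
  "'v set \<Rightarrow> ('v \<Rightarrow> 'a measure) \<Rightarrow> ('v, 'a) schedule measure \<Rightarrow> bool" where
  "consistent V S P \<longleftrightarrow>
     (\<forall>I I' x. I \<subseteq> V \<longrightarrow> I' \<subseteq> V \<longrightarrow> I \<inter> I' = {} \<longrightarrow> x \<in> space (PiM I S) \<longrightarrow>
        (\<exists>\<kappa>. regular_conditional_prob P (PiM I' S) (\<lambda>s. \<lambda>i\<in>I'. s (i, impose x I)) \<kappa> \<and>
             (\<forall>y\<in>space (PiM I' S). AE s in \<kappa> y.
                \<forall>v\<in>V. s (v, impose x I ++ impose y I') = s (v, impose x I))))"

definition ground_model ::
  "'v set \<Rightarrow> ('v \<Rightarrow> 'a measure) \<Rightarrow> ('v, 'a) schedule measure \<Rightarrow> ('v, 'a) schedule measure set" where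
  "ground_model V S \<Omega> = {P \<in> space (prob_algebra \<Omega>). regular_law V S P \<and> consistent V S P}"

definition parents :: "'v rel \<Rightarrow> 'v \<Rightarrow> 'v set" where
  "parents E v = {w. (w, v) \<in> E}"

definition dag_model ::
  "'v set \<Rightarrow> ('v \<Rightarrow> 'a measure) \<Rightarrow> ('v, 'a) schedule measure \<Rightarrow> 'v rel
     \<Rightarrow> ('v, 'a) schedule measure set" where
  "dag_model V S \<Omega> E = {P \<in> ground_model V S \<Omega>.
     (\<forall>v\<in>V. \<forall>I x. I \<subseteq> V \<longrightarrow> x \<in> space (PiM V S) \<longrightarrow>
        (AE s in P. s (v, impose x I) = s (v, substitute s x I (parents E v)))) \<and>
     (\<forall>x\<in>space (PiM V S).
        prob_space.indep_vars P S (\<lambda>v s. s (v, impose x (parents E v))) V)}"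


section \<open>The poset of DAGs and its distance\<close>

text \<open>The graph \<open>(V, E)\<close> is represented by its edge set, since \<open>V\<close> is common to all graphs.\<close>

definition dags :: "'v set \<Rightarrow> 'v rel set" where
  "dags V = {E. E \<subseteq> V \<times> V \<and> acyclic E}"

definition dag_le ::
  "'v set \<Rightarrow> ('v \<Rightarrow> 'a measure) \<Rightarrow> ('v, 'a) schedule measure \<Rightarrow> 'v rel \<Rightarrow> 'v rel \<Rightarrow> bool" where
  "dag_le V S \<Omega> D1 D2 \<longleftrightarrow> dag_model V S \<Omega> D1 \<subseteq> dag_model V S \<Omega> D2"

definition covered_by :: "'g set \<Rightarrow> ('g \<Rightarrow> 'g \<Rightarrow> bool) \<Rightarrow> 'g \<Rightarrow> 'g \<Rightarrow> bool" where
  "covered_by G le x y \<longleftrightarrow>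
     x \<in> G \<and> y \<in> G \<and> le x y \<and> x \<noteq> y \<and>
     \<not> (\<exists>z\<in>G. le x z \<and> x \<noteq> z \<and> le z y \<and> z \<noteq> y)"

text \<open>The infimum in \<open>enat\<close> is a minimum, and is infinite if no connecting sequence exists.\<close>

definition poset_dist :: "'g set \<Rightarrow> ('g \<Rightarrow> 'g \<Rightarrow> bool) \<Rightarrow> 'g \<Rightarrow> 'g \<Rightarrow> enat" where
  "poset_dist G le a b =
     (INF n\<in>{n. (a, b) \<in> {(x, y). covered_by G le x y \<or> covered_by G le y x} ^^ n}. enat n)"

definition dag_dist ::
  "'v set \<Rightarrow> ('v \<Rightarrow> 'a measure) \<Rightarrow> ('v, 'a) schedule measure \<Rightarrow> 'v rel \<Rightarrow> 'v rel \<Rightarrow> enat" where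
  "dag_dist V S \<Omega> = poset_dist (dags V) (dag_le V S \<Omega>)"


section \<open>Structural Hamming distances\<close>

definition adj :: "'v rel \<Rightarrow> 'v \<Rightarrow> 'v \<Rightarrow> nat" where
  "adj E i j = (if (i, j) \<in> E then 1 else 0)"

definition SHD1 :: "'v::linorder set \<Rightarrow> 'v rel \<Rightarrow> 'v rel \<Rightarrow> nat" where
  "SHD1 V Es Et =
     (\<Sum>(i, j)\<in>{(i, j). i \<in> V \<and> j \<in> V \<and> i < j}.
        of_bool (adj Es i j \<noteq> adj Et i j \<or> adj Es j i \<noteq> adj Et j i))"

definition SHD2 :: "'v set \<Rightarrow> 'v rel \<Rightarrow> 'v rel \<Rightarrow> nat" where
  "SHD2 V Es Et = (\<Sum>(i, j)\<in>V \<times> V. of_bool (adj Es i j \<noteq> adj Et i j))"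


section \<open>The countable case\<close>

text \<open>
  For countable discrete state spaces the cylinder sigma-algebra is suitable and every law is
  regular, so neither notion is a restriction.
\<close>

lemma space_cylinder_component:
  assumes "s \<in> space (cylinder_space V S)" "v \<in> V" "m \<in> interventions V S"
  shows "s (v, m) \<in> space (S v)"
proof -
  have "s (v, m) \<in> (case (v, m) of (v, m) \<Rightarrow> space (S v))"
    using assms PiE_mem[of s "V \<times> interventions V S" "\<lambda>p. space (case p of (v, m) \<Rightarrow> S v)" "(v, m)"]
    by (simp add: cylinder_space_def space_PiM)
  then show ?thesis by simp
qed

lemma impose_in_interventions:
  assumes "x \<in> space (PiM V S)" "I \<subseteq> V"
  shows "impose x I \<in> interventions V S"
proof -
  have "impose x I = impose (restrict x I) I"
    by (auto simp: impose_def)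
  moreover have "restrict x I \<in> space (PiM I S)"
    using assms by (auto simp: space_PiM)
  ultimately show ?thesis
    using assms unfolding interventions_def by blast
qed

lemma substitute_eq_impose:
  "substitute s x I K = impose (\<lambda>w. if w \<in> I then x w else s (w, impose x I)) K"
  by (auto simp: substitute_def impose_def map_add_def fun_eq_iff)

lemma suitable_cylinder_space_countable:
  assumes fin: "finite V"
    and cnt: "\<And>v. v \<in> V \<Longrightarrow> countable (space (S v))"
    and discrete: "\<And>v. v \<in> V \<Longrightarrow> sets (S v) = Pow (space (S v))"
  shows "suitable_sigma_algebras V S (cylinder_space V S)"
proof -
  let ?C = "cylinder_space V S" and ?X = "space (PiM V S)"
  have cX: "countable ?X"
    unfolding space_PiM using fin cnt by (intro countable_PiE)
  have coord: "(\<lambda>s. s (v, m)) \<in> ?C \<rightarrow>\<^sub>M S v" if "v \<in> V" "m \<in> interventions V S" for v m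
    using measurable_component_singleton[of "(v, m)" "V \<times> interventions V S" "\<lambda>(v, m). S v"] that
    by (simp add: cylinder_space_def)
  have point: "{s \<in> space M. f s = a} \<in> sets M"
    if "v \<in> V" "f \<in> M \<rightarrow>\<^sub>M S v" "a \<in> space (S v)"
    for v and M :: "'c measure" and f a
  proof -
    have "f -` {a} \<inter> space M \<in> sets M"
      using that discrete by (intro measurable_sets[of f M "S v"]) auto
    also have "f -` {a} \<inter> space M = {s \<in> space M. f s = a}" by auto
    finally show ?thesis .
  qed
  have eq: "{s \<in> space M. f s = g s} \<in> sets M"
    if v: "v \<in> V" and f: "f \<in> M \<rightarrow>\<^sub>M S v" and g: "g \<in> M \<rightarrow>\<^sub>M S v"
    for v and M :: "'c measure" and f g
  proof -
    have "{s \<in> space M. f s = g s} =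
        (\<Union>a\<in>space (S v). {s \<in> space M. f s = a} \<inter> {s \<in> space M. g s = a})"
      using measurable_space[OF f] measurable_space[OF g] by auto
    also have "\<dots> \<in> sets M"
      using v f g cnt by (intro sets.countable_UN' sets.Int) (auto intro: point)
    finally show ?thesis .
  qed
  have diag: "{p \<in> space (S v \<Otimes>\<^sub>M S v). fst p = snd p} \<in> sets (S v \<Otimes>\<^sub>M S v)" if v: "v \<in> V" for v
  proof -
    have "{p \<in> space (S v \<Otimes>\<^sub>M S v). fst p = snd p} = (\<Union>a\<in>space (S v). {a} \<times> {a})"
      by (auto simp: space_pair_measure)
    also have "\<dots> \<in> sets (S v \<Otimes>\<^sub>M S v)"
    proof (intro sets.countable_UN'[OF cnt[OF v]] image_subsetI)
      fix a assume "a \<in> space (S v)"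
      then have "{a} \<in> sets (S v)" using discrete[OF v] by simp
      then show "{a} \<times> {a} \<in> sets (S v \<Otimes>\<^sub>M S v)" by (intro pair_measureI)
    qed
    finally show ?thesis .
  qed
  have subst: "{s \<in> space ?C. s (v, impose x I) = s (v, substitute s x I K)} \<in> sets ?C"
    if v: "v \<in> V" and I: "I \<subseteq> V" and K: "K \<subseteq> V" and x: "x \<in> ?X" for v I K x
  proof -
    let ?A = "\<lambda>y. {s \<in> space ?C. s (v, impose x I) = s (v, impose y K)}"
    let ?B = "\<lambda>y w. {s \<in> space ?C. (if w \<in> I then x w else s (w, impose x I)) = y w}"
    have B: "?B y w \<in> sets ?C" if "y \<in> ?X" "w \<in> K" for y w
    proof (cases "w \<in> I")
      case True
      then show ?thesis by (cases "x w = y w") auto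
    next
      case False
      then show ?thesis
        using that K x I by (auto simp: space_PiM intro!: point[of w] coord impose_in_interventions)
    qed
    have "{s \<in> space ?C. s (v, impose x I) = s (v, substitute s x I K)} =
        (\<Union>y\<in>?X. ?A y \<inter> {s \<in> space ?C. \<forall>w\<in>K. s \<in> ?B y w})" (is "?L = ?R")
    proof (intro equalityI subsetI)
      fix s assume s: "s \<in> ?L"
      let ?y = "\<lambda>w\<in>V. if w \<in> I then x w else s (w, impose x I)"
      have "?y \<in> ?X"
        using s x space_cylinder_component[of s V S] impose_in_interventions[OF x I]
        by (auto simp: space_PiM)
      moreover have "substitute s x I K = impose ?y K"
        using K by (auto simp: substitute_eq_impose impose_def fun_eq_iff)
      ultimately show "s \<in> ?R" using s K by (intro UN_I[of ?y]) auto
    next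
      fix s assume "s \<in> ?R"
      then obtain y where y: "s \<in> ?A y" "\<forall>w\<in>K. s \<in> ?B y w" by blast
      then have "substitute s x I K = impose y K"
        by (auto simp: substitute_eq_impose impose_def fun_eq_iff)
      then show "s \<in> ?L" using y by auto
    qed
    also have "\<dots> \<in> sets ?C"
    proof (intro sets.countable_UN'[OF cX] sets.Int image_subsetI)
      fix y assume y: "y \<in> ?X"
      show "?A y \<in> sets ?C"
        using v x y I K by (intro eq[of v] coord impose_in_interventions) auto
      have "{s \<in> space ?C. s \<in> ?B y w} \<in> sets ?C" if "w \<in> K" for w
        using B[OF y that] by simp
      then show "{s \<in> space ?C. \<forall>w\<in>K. s \<in> ?B y w} \<in> sets ?C"
        using finite_subset[OF K fin] by (rule sets.sets_Collect_finite_All)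
    qed
    finally show ?thesis .
  qed
  have unif: "{s \<in> space ?C. \<forall>x\<in>?X. s (v, impose x I) = s (v, impose x J)} \<in> sets ?C"
    if "v \<in> V" "I \<subseteq> V" "J \<subseteq> V" for v I J
    using that by (intro sets.sets_Collect_countable_All'[OF _ cX] eq[of v] coord
        impose_in_interventions) auto
  show ?thesis
    using diag subst unif by (simp add: suitable_sigma_algebras_def)
qed

lemma regular_law_countable:
  assumes "finite V" "\<And>v. v \<in> V \<Longrightarrow> countable (space (S v))"
  shows "regular_law V S P"
proof -
  have "countable (space (PiM V S))"
    unfolding space_PiM using assms by (intro countable_PiE)
  then show ?thesis
    by (simp add: regular_law_def AE_ball_countable)
qed

end

theory Submission
  imports Defs
begin

text \<open>
  The model order is edge inclusion. If \<open>E \<subseteq> E'\<close>, recursive substitution for \<open>E\<close> shows that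
  imposing values on the parents in \<open>E'\<close> acts like imposing them on the parents in \<open>E\<close>; regularity
  of the law makes this usable at the random interventions of recursive substitution for \<open>E'\<close>.
  Conversely, an edge \<open>w \<rightarrow> v\<close> that is missing in \<open>E'\<close> is detected by a point mass at a schedule in
  which only \<open>v\<close> reacts to interventions, and only to those on \<open>w\<close>. Hence a DAG covers another one
  iff it has exactly one additional edge, and since subgraphs of DAGs are DAGs, a shortest path runs
  through the common subgraph.
\<close>

section \<open>Probability\<close>

text \<open>Independence is a family of product formulas over finite sets of indices, and in each of
  them the modification changes the events only by null sets. This moves independence from one
  choice of parent sets to a larger one.\<close>

lemma (in prob_space) indep_vars_cong_AE:
  assumes indep: "indep_vars N X I"
    and Y: "\<And>i. i \<in> I \<Longrightarrow> random_variable (N i) (Y i)"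
    and ae: "\<And>i. i \<in> I \<Longrightarrow> AE s in M. X i s = Y i s"
  shows "indep_vars N Y I"
  unfolding indep_vars_def2 indep_sets_def
proof (intro conjI ballI allI impI Y)
  have X: "random_variable (N i) (X i)" if "i \<in> I" for i
    using indep that by (simp add: indep_vars_def2)
  show "{Y i -` A \<inter> space M |A. A \<in> sets (N i)} \<subseteq> events" if "i \<in> I" for i
    using measurable_sets[OF Y[OF that]] by auto
  fix J A assume J: "J \<subseteq> I" "J \<noteq> {}" "finite J"
    and "A \<in> (\<Pi> i\<in>J. {Y i -` A \<inter> space M |A. A \<in> sets (N i)})"
  then have "\<forall>i\<in>J. \<exists>B. B \<in> sets (N i) \<and> A i = Y i -` B \<inter> space M"
    by (auto simp: Pi_iff)
  then obtain B where B: "\<And>i. i \<in> J \<Longrightarrow> B i \<in> sets (N i)"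
    and A: "\<And>i. i \<in> J \<Longrightarrow> A i = Y i -` B i \<inter> space M"
    by metis
  define C where "C i = X i -` B i \<inter> space M" for i
  have C: "C i \<in> events" and A': "A i \<in> events" if "i \<in> J" for i
    using measurable_sets[OF X B] measurable_sets[OF Y B] J that unfolding C_def A[OF that] by auto
  \<comment> \<open>Finiteness of \<open>J\<close> gives one null set outside which all the
    variables agree, so the two intersections differ by a null set.\<close>
  have aeJ: "AE s in M. \<forall>i\<in>J. X i s = Y i s"
    using J ae by (intro AE_finite_allI) auto
  have "prob (\<Inter>i\<in>J. A i) = prob (\<Inter>i\<in>J. C i)"
    using aeJ J C A' by (intro finite_measure_eq_AE sets.finite_INT) (auto simp: A C_def)
  also have "\<dots> = (\<Prod>i\<in>J. prob (C i))"
  proof -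
    have "indep_sets (\<lambda>i. {X i -` A \<inter> space M |A. A \<in> sets (N i)}) I"
      using indep by (simp add: indep_vars_def2)
    moreover have "\<forall>i\<in>J. C i \<in> {X i -` A \<inter> space M |A. A \<in> sets (N i)}"
      using B unfolding C_def by blast
    ultimately show ?thesis using J by (intro indep_setsD)
  qed
  also have "\<dots> = (\<Prod>i\<in>J. prob (A i))"
  proof (intro prod.cong refl)
    fix i assume i: "i \<in> J"
    then have "AE s in M. X i s = Y i s" using J ae by blast
    then have "AE s in M. s \<in> C i \<longleftrightarrow> s \<in> A i"
      by eventually_elim (simp add: A[OF i] C_def)
    then show "prob (C i) = prob (A i)" using C[OF i] A'[OF i] by (rule finite_measure_eq_AE)
  qed
  finally show "prob (\<Inter>i\<in>J. A i) = (\<Prod>i\<in>J. prob (A i))" .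
qed

section \<open>Point masses and diagonals\<close>

lemma indep_vars_return:
  assumes s: "s \<in> space M" and X: "\<And>i. i \<in> I \<Longrightarrow> X i \<in> M \<rightarrow>\<^sub>M N i"
  shows "prob_space.indep_vars (return M s) N X I"
proof -
  interpret prob_space "return M s" using s by (rule prob_space_return)
  show ?thesis
    unfolding indep_vars_def2 indep_sets_def
  proof (intro conjI ballI allI impI)
    show "random_variable (N i) (X i)" if "i \<in> I" for i
      using X[OF that] by simp
    show "{X i -` A \<inter> space (return M s) |A. A \<in> sets (N i)} \<subseteq> events" if "i \<in> I" for i
      using measurable_sets[OF X[OF that]] by auto
    fix J A assume J: "J \<subseteq> I" "J \<noteq> {}" "finite J"
      and "A \<in> (\<Pi> i\<in>J. {X i -` A \<inter> space (return M s) |A. A \<in> sets (N i)})"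
    then have A: "A i \<in> sets M" if "i \<in> J" for i
      using that measurable_sets[OF X] by (fastforce simp: Pi_iff)
    \<comment> \<open>Under a point mass the probability of an event is its indicator at
      \<open>s\<close>, and indicators turn intersections into products.\<close>
    have "(indicator (\<Inter>i\<in>J. A i) s :: real) = (\<Prod>i\<in>J. indicator (A i) s)"
      using J by (auto simp: indicator_def)
    then show "prob (\<Inter>i\<in>J. A i) = (\<Prod>i\<in>J. prob (A i))"
      using A J by (simp add: measure_return sets.finite_INT)
  qed
qed

lemma return_in_prob_algebra: "s \<in> space M \<Longrightarrow> return M s \<in> space (prob_algebra M)"
  by (simp add: space_prob_algebra prob_space_return)

text \<open>The exceptional set lies in a measurable null set, and a null set of the point mass
  cannot contain \<open>t\<close>.\<close>

lemma AE_returnD: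
  assumes "AE s in return M t. Q s" "t \<in> space M"
  shows "Q t"
proof -
  obtain N where N: "{s \<in> space (return M t). \<not> Q s} \<subseteq> N" "emeasure (return M t) N = 0"
    "N \<in> sets (return M t)"
    using assms(1) by (rule AE_E)
  then have "t \<notin> N" by (auto simp: indicator_def split: if_splits)
  then show ?thesis using N assms(2) by auto
qed

lemma AE_returnI:
  assumes "{s \<in> space M. Q s} \<in> sets M" "Q t" "t \<in> space M"
  shows "AE s in return M t. Q s"
  using AE_return[of t M Q] assms by (simp add: pred_def)

text \<open>The section of the diagonal at \<open>a\<close> is \<open>{a}\<close>. Measurable
  singletons are what allows conditioning on one observed value.\<close>

lemma singleton_in_sets_of_diagonal:
  assumes "{p \<in> space (M \<Otimes>\<^sub>M M). fst p = snd p} \<in> sets (M \<Otimes>\<^sub>M M)" "a \<in> space M"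
  shows "{a} \<in> sets M"
proof -
  have "Pair a -` {p \<in> space (M \<Otimes>\<^sub>M M). fst p = snd p} \<in> sets M"
    using assms(1) by (rule sets_Pair1)
  also have "Pair a -` {p \<in> space (M \<Otimes>\<^sub>M M). fst p = snd p} = {a}"
    using assms(2) by (auto simp: space_pair_measure)
  finally show ?thesis .
qed

lemma sets_Collect_eq_of_diagonal:
  assumes "{p \<in> space (N \<Otimes>\<^sub>M N). fst p = snd p} \<in> sets (N \<Otimes>\<^sub>M N)"
    and "f \<in> M \<rightarrow>\<^sub>M N" "g \<in> M \<rightarrow>\<^sub>M N"
  shows "{s \<in> space M. f s = g s} \<in> sets M"
proof -
  have "(\<lambda>s. (f s, g s)) -` {p \<in> space (N \<Otimes>\<^sub>M N). fst p = snd p} \<inter> space M \<in> sets M"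
    using assms by (intro measurable_sets[of _ M "N \<Otimes>\<^sub>M N"] measurable_Pair) auto
  also have "(\<lambda>s. (f s, g s)) -` {p \<in> space (N \<Otimes>\<^sub>M N). fst p = snd p} \<inter> space M
      = {s \<in> space M. f s = g s}"
    using measurable_space[OF assms(2)] measurable_space[OF assms(3)]
    by (auto simp: space_pair_measure)
  finally show ?thesis .
qed

text \<open>Only the value of the kernel at \<open>Y t\<close> is determined; elsewhere it may be any point mass.\<close>

lemma regular_conditional_prob_return:
  assumes t: "t \<in> space M" and t': "t' \<in> space M"
    and Y: "Y \<in> M \<rightarrow>\<^sub>M N" and single: "{Y t} \<in> sets N"
  shows "regular_conditional_prob (return M t) N Y (\<lambda>y. return M (if y = Y t then t else t'))"
    (is "regular_conditional_prob _ _ _ ?\<kappa>")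
proof -
  have "(\<lambda>y. if y = Y t then t else t') \<in> N \<rightarrow>\<^sub>M M"
  proof (intro measurable_If measurable_const t t')
    have "{y \<in> space N. y = Y t} = {Y t}"
      using measurable_space[OF Y t] by auto
    then show "{y \<in> space N. y = Y t} \<in> sets N" using single by simp
  qed
  then have \<kappa>: "?\<kappa> \<in> N \<rightarrow>\<^sub>M prob_algebra M"
    by (rule measurable_compose[OF _ measurable_return_prob_space])
  have alg: "prob_algebra (return M t) = prob_algebra M"
    by (simp add: prob_algebra_def cong: subprob_algebra_cong)
  have "emeasure (return M t) (A \<inter> (Y -` B \<inter> space (return M t))) =
      (\<integral>\<^sup>+y\<in>B. emeasure (?\<kappa> y) A \<partial>distr (return M t) N Y)"
    if A: "A \<in> sets M" and B: "B \<in> sets N" for A B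
  proof -
    have "A \<inter> (Y -` B \<inter> space M) \<in> sets M"
      using A B Y by (intro sets.Int measurable_sets) auto
    then have "emeasure (return M t) (A \<inter> (Y -` B \<inter> space (return M t))) =
        indicator A t * indicator B (Y t)"
      using t by (simp add: indicator_def)
    moreover have "(\<lambda>y. emeasure (?\<kappa> y) A * indicator B y) \<in> borel_measurable N"
      using A B by (intro borel_measurable_times_ennreal borel_measurable_indicator
          measurable_emeasure_kernel[OF measurable_prob_algebraD[OF \<kappa>]])
    \<comment> \<open>The law of \<open>Y\<close> is the point mass at \<open>Y t\<close>, so the
      integral evaluates the kernel there, where it equals \<open>return M t\<close>.\<close>
    ultimately show ?thesis
      using A t Y measurable_space[OF Y t] by (simp add: distr_return nn_integral_return)
  qed
  then show ?thesis
    using Y \<kappa> by (simp add: regular_conditional_prob_def alg)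
qed


section \<open>The order of the DAG models\<close>

lemma measurable_outcome:
  assumes "suitable_sigma_algebras V S \<Omega>" "v \<in> V" "m \<in> interventions V S"
  shows "(\<lambda>s. s (v, m)) \<in> \<Omega> \<rightarrow>\<^sub>M S v"
proof -
  have "(\<lambda>s. s (v, m)) \<in> cylinder_space V S \<rightarrow>\<^sub>M S v"
    using measurable_component_singleton[of "(v, m)" "V \<times> interventions V S" "\<lambda>(v, m). S v"] assms
    by (simp add: cylinder_space_def)
  then show ?thesis
    using assms(1) by (auto simp: suitable_sigma_algebras_def measurable_def)
qed

text \<open>The state takes \<open>x\<close> on \<open>I\<close> and the realised outcomes
  elsewhere. It is the same for all \<open>K\<close>, which makes the substitutions for two parent
  sets comparable at a fixed schedule.\<close>

lemma substitute_eq_impose_state: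
  assumes s: "s \<in> space (cylinder_space V S)" and x: "x \<in> space (PiM V S)" and I: "I \<subseteq> V"
  obtains y where "y \<in> space (PiM V S)" "\<And>K. K \<subseteq> V \<Longrightarrow> substitute s x I K = impose y K"
proof
  let ?y = "\<lambda>w\<in>V. if w \<in> I then x w else s (w, impose x I)"
  show "?y \<in> space (PiM V S)"
    using x space_cylinder_component[OF s] impose_in_interventions[OF x I]
    by (auto simp: space_PiM)
  show "substitute s x I K = impose ?y K" if "K \<subseteq> V" for K
    using that by (auto simp: substitute_eq_impose impose_def fun_eq_iff)
qed

lemma parents_subset: "E \<subseteq> V \<times> V \<Longrightarrow> parents E v \<subseteq> V"
  by (auto simp: parents_def)

section \<open>Monotonicity of the models in the edge set\<close>

lemma dag_model_mono:
  assumes suit: "suitable_sigma_algebras V S \<Omega>"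
    and E: "E \<subseteq> E'" and E': "E' \<subseteq> V \<times> V"
  shows "dag_model V S \<Omega> E \<subseteq> dag_model V S \<Omega> E'"
proof
  fix P assume P: "P \<in> dag_model V S \<Omega> E"
  have reg: "regular_law V S P" and PG: "P \<in> ground_model V S \<Omega>"
    and sets_P: "sets P = sets \<Omega>" and prob: "prob_space P"
    using P by (auto simp: dag_model_def ground_model_def space_prob_algebra)
  have space_P: "space P = space (cylinder_space V S)"
    using suit sets_eq_imp_space_eq[OF sets_P] by (simp add: suitable_sigma_algebras_def)
  have par: "parents E v \<subseteq> V" "parents E' v \<subseteq> V" "parents E v \<subseteq> parents E' v" for v
    using E E' by (auto simp: parents_def)
  have subst: "AE s in P. s (v, impose x I) = s (v, substitute s x I (parents E v))"
    if "v \<in> V" "I \<subseteq> V" "x \<in> space (PiM V S)" for v I x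
    using P that by (simp add: dag_model_def)
  have eq: "AE s in P. s (v, impose x (parents E' v)) = s (v, impose x (parents E v))"
    if "v \<in> V" "x \<in> space (PiM V S)" for v x
  proof -
    \<comment> \<open>Values are imposed on all of \<open>parents E' v\<close>, hence on all of
      \<open>parents E v\<close>, so no random outcome enters.\<close>
    have "substitute s x (parents E' v) (parents E v) = impose x (parents E v)" for s
      using par(3)[of v] by (auto simp: substitute_eq_impose impose_def fun_eq_iff)
    then show ?thesis using subst[OF that(1) par(2) that(2), of v] by simp
  qed
  \<comment> \<open>In \<open>eq\<close> the null set depends on \<open>x\<close>; regularity of the
    law provides one null set for all \<open>x\<close>.\<close>
  have uniform: "AE s in P. \<forall>x\<in>space (PiM V S).
      s (v, impose x (parents E' v)) = s (v, impose x (parents E v))" if "v \<in> V" for v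
    using reg[unfolded regular_law_def, rule_format, OF that par(2,1)] eq[OF that] by blast
  have "AE s in P. s (v, impose x I) = s (v, substitute s x I (parents E' v))"
    if v: "v \<in> V" and I: "I \<subseteq> V" and x: "x \<in> space (PiM V S)" for v I x
    using subst[OF v I x] uniform[OF v] AE_space
  proof eventually_elim
    case (elim s)
    \<comment> \<open>The state \<open>y\<close> depends on \<open>s\<close>, so \<open>eq\<close>
      for a fixed state could not be applied to it, but \<open>uniform\<close> can.\<close>
    obtain y where "y \<in> space (PiM V S)" "\<And>K. K \<subseteq> V \<Longrightarrow> substitute s x I K = impose y K"
      using substitute_eq_impose_state[OF _ x I, of s] elim(3) space_P by metis
    then show ?case using elim(1,2) par(1,2)[of v] by simp
  qed
  moreover have "prob_space.indep_vars P S (\<lambda>v s. s (v, impose x (parents E' v))) V"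
    if x: "x \<in> space (PiM V S)" for x
  proof (rule prob_space.indep_vars_cong_AE[OF prob])
    show "prob_space.indep_vars P S (\<lambda>v s. s (v, impose x (parents E v))) V"
      using P x by (simp add: dag_model_def)
    show "(\<lambda>s. s (v, impose x (parents E' v))) \<in> P \<rightarrow>\<^sub>M S v" if "v \<in> V" for v
      using measurable_outcome[OF suit that impose_in_interventions[OF x par(2)]] sets_P
      by (simp cong: measurable_cong_sets)
    show "AE s in P. s (v, impose x (parents E v)) = s (v, impose x (parents E' v))"
      if "v \<in> V" for v
      using eq[OF that x] by eventually_elim simp
  qed
  ultimately show "P \<in> dag_model V S \<Omega> E'"
    using PG by (simp add: dag_model_def)
qed

section \<open>A point mass that detects one edge\<close>

text \<open>For \<open>d = c v\<close> this schedule ignores all interventions.\<close>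

definition edge_schedule ::
  "'v set \<Rightarrow> ('v \<Rightarrow> 'a measure) \<Rightarrow> ('v \<Rightarrow> 'a) \<Rightarrow> 'v \<Rightarrow> 'v \<Rightarrow> 'a \<Rightarrow> ('v, 'a) schedule" where
  "edge_schedule V S c w v d = (\<lambda>(u, m)\<in>V \<times> interventions V S.
     if u = v \<and> m w \<noteq> None \<and> m w \<noteq> Some (c w) then d else c u)"

lemma edge_schedule_in_space:
  assumes "suitable_sigma_algebras V S \<Omega>" "c \<in> space (PiM V S)" "v \<in> V" "d \<in> space (S v)"
  shows "edge_schedule V S c w v d \<in> space \<Omega>"
proof -
  have "edge_schedule V S c w v d \<in> space (cylinder_space V S)"
    using assms by (auto simp: edge_schedule_def cylinder_space_def space_PiM PiE_iff)
  then show ?thesis using assms(1) by (simp add: suitable_sigma_algebras_def)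
qed

lemma edge_schedule_apply:
  "u \<in> V \<Longrightarrow> m \<in> interventions V S \<Longrightarrow> edge_schedule V S c w v d (u, m) =
     (if u = v \<and> m w \<noteq> None \<and> m w \<noteq> Some (c w) then d else c u)"
  by (simp add: edge_schedule_def)

lemma impose_in_interventions':
  assumes "x \<in> space (PiM I S)" "I \<subseteq> V"
  shows "impose x I \<in> interventions V S"
  using assms unfolding interventions_def by blast

lemma impose_add_in_interventions:
  assumes x: "x \<in> space (PiM I S)" and y: "y \<in> space (PiM J S)" and IJ: "I \<subseteq> V" "J \<subseteq> V"
  shows "impose x I ++ impose y J \<in> interventions V S"
proof -
  let ?z = "\<lambda>i\<in>I \<union> J. if i \<in> J then y i else x i"
  have "impose x I ++ impose y J = impose ?z (I \<union> J)"
    by (auto simp: impose_def map_add_def fun_eq_iff)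
  moreover have "?z \<in> space (PiM (I \<union> J) S)"
    using x y by (auto simp: space_PiM PiE_iff)
  ultimately show ?thesis using impose_in_interventions'[of ?z "I \<union> J" S V] IJ by simp
qed

lemma singleton_in_sets_PiM:
  assumes "finite I" "x \<in> space (PiM I S)" "\<And>i. i \<in> I \<Longrightarrow> {x i} \<in> sets (S i)"
  shows "{x} \<in> sets (PiM I S)"
proof -
  have "Pi\<^sub>E I (\<lambda>i. {x i}) \<in> sets (PiM I S)"
    using assms by (intro sets_PiM_I_finite) auto
  then show ?thesis using assms(2) by (simp add: PiE_singleton space_PiM PiE_iff)
qed

text \<open>Consistency is required at every value \<open>y\<close>, not only at the observed one.
  The kernel is therefore the point mass at the schedule itself for the observed value, and at the
  schedule ignoring all interventions for every other value.\<close>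

lemma consistent_edge_schedule:
  assumes fin: "finite V" and suit: "suitable_sigma_algebras V S \<Omega>"
    and c: "c \<in> space (PiM V S)" and v: "v \<in> V" and d: "d \<in> space (S v)" and wv: "w \<noteq> v"
  shows "consistent V S (return \<Omega> (edge_schedule V S c w v d))"
  unfolding consistent_def
proof (intro allI impI)
  fix I J x assume I: "I \<subseteq> V" and J: "J \<subseteq> V" and disj: "I \<inter> J = {}" and x: "x \<in> space (PiM I S)"
  let ?t = "edge_schedule V S c w v d" and ?t' = "edge_schedule V S c w v (c v)"
  let ?Y = "\<lambda>s. \<lambda>i\<in>J. s (i, impose x I)"
  let ?\<kappa> = "\<lambda>y. return \<Omega> (if y = ?Y ?t then ?t else ?t')"
  have t: "?t \<in> space \<Omega>" and t': "?t' \<in> space \<Omega>"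
    using edge_schedule_in_space[OF suit c v] d c v by (auto simp: space_PiM)
  have mx: "impose x I \<in> interventions V S"
    using impose_in_interventions' x I by blast
  have diag: "{p \<in> space (S u \<Otimes>\<^sub>M S u). fst p = snd p} \<in> sets (S u \<Otimes>\<^sub>M S u)" if "u \<in> V" for u
    using suit that by (simp add: suitable_sigma_algebras_def)
  have Y: "?Y \<in> \<Omega> \<rightarrow>\<^sub>M PiM J S"
    using J mx by (intro measurable_restrict measurable_outcome[OF suit]) auto
  have "{?Y ?t} \<in> sets (PiM J S)"
  proof (rule singleton_in_sets_PiM)
    show "finite J" using J fin by (rule finite_subset)
    show in_J: "?Y ?t \<in> space (PiM J S)" using measurable_space[OF Y t] .
    show "{?Y ?t i} \<in> sets (S i)" if "i \<in> J" for i
      using singleton_in_sets_of_diagonal[OF diag, of i "?Y ?t i"] in_J that J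
      by (auto simp: space_PiM)
  qed
  then have rcp: "regular_conditional_prob (return \<Omega> ?t) (PiM J S) ?Y ?\<kappa>"
    using t t' Y by (intro regular_conditional_prob_return)
  have ae: "AE s in ?\<kappa> y. \<forall>u\<in>V. s (u, impose x I ++ impose y J) = s (u, impose x I)"
    if y: "y \<in> space (PiM J S)" for y
  proof (rule AE_returnI)
    have my: "impose x I ++ impose y J \<in> interventions V S"
      using impose_add_in_interventions[OF x y I J] .
    have "{s \<in> space \<Omega>. s (u, impose x I ++ impose y J) = s (u, impose x I)} \<in> sets \<Omega>"
      if "u \<in> V" for u
      using that mx my
      by (intro sets_Collect_eq_of_diagonal[OF diag, of u] measurable_outcome[OF suit])
    then show "{s \<in> space \<Omega>. \<forall>u\<in>V. s (u, impose x I ++ impose y J) = s (u, impose x I)} \<in> sets \<Omega>"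
      using fin by (intro sets.sets_Collect_finite_All)
    \<comment> \<open>As \<open>w\<close> differs from \<open>v\<close>, its outcome is always
      \<open>c w\<close>, a value to which \<open>v\<close> does not react.\<close>
    have yw: "y w = c w" if "y = ?Y ?t" "w \<in> J"
      using that wv J mx by (auto simp: edge_schedule_apply)
    show "\<forall>u\<in>V. (if y = ?Y ?t then ?t else ?t') (u, impose x I ++ impose y J) =
        (if y = ?Y ?t then ?t else ?t') (u, impose x I)"
    proof (cases "y = ?Y ?t")
      case True
      \<comment> \<open>If \<open>w\<close> is in \<open>J\<close>, it is not in \<open>I\<close>,
        and \<open>v\<close> stays at \<open>c v\<close> under both interventions. Otherwise the two
        interventions agree at \<open>w\<close>.\<close>
      then show ?thesis
        using yw disj mx my
        by (auto simp: edge_schedule_apply) (auto simp: impose_def map_add_def split: if_splits)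
    next
      case False
      then show ?thesis using mx my by (auto simp: edge_schedule_apply)
    qed
    show "(if y = ?Y ?t then ?t else ?t') \<in> space \<Omega>" using t t' by simp
  qed
  show "\<exists>\<kappa>. regular_conditional_prob (return \<Omega> ?t) (PiM J S) ?Y \<kappa> \<and>
      (\<forall>y\<in>space (PiM J S). AE s in \<kappa> y.
         \<forall>u\<in>V. s (u, impose x I ++ impose y J) = s (u, impose x I))"
    by (intro exI[of _ ?\<kappa>] conjI ballI rcp ae)
qed

text \<open>The parent \<open>w\<close> of \<open>v\<close> carries the only intervention that
  matters. If \<open>w\<close> is not imposed, substitution sets it to its outcome
  \<open>c w\<close>, which leaves \<open>v\<close> at \<open>c v\<close>. Independence is automatic
  for a point mass.\<close>

lemma return_edge_schedule_in_dag_model: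
  assumes fin: "finite V" and suit: "suitable_sigma_algebras V S \<Omega>"
    and c: "c \<in> space (PiM V S)" and w: "w \<in> V" and v: "v \<in> V" and d: "d \<in> space (S v)"
    and wv: "w \<noteq> v"
  shows "return \<Omega> (edge_schedule V S c w v d) \<in> dag_model V S \<Omega> {(w, v)}"
proof -
  let ?t = "edge_schedule V S c w v d" and ?P = "return \<Omega> (edge_schedule V S c w v d)"
  have t: "?t \<in> space \<Omega>" using edge_schedule_in_space[OF suit c v d] .
  have t_cyl: "?t \<in> space (cylinder_space V S)"
    using suit t by (simp add: suitable_sigma_algebras_def)
  have par: "parents {(w, v)} u \<subseteq> V" for u using w by (auto simp: parents_def)
  have events:
    "\<forall>u\<in>V. \<forall>I K x. I \<subseteq> V \<longrightarrow> K \<subseteq> V \<longrightarrow> x \<in> space (PiM V S) \<longrightarrow>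
       {s \<in> space \<Omega>. s (u, impose x I) = s (u, substitute s x I K)} \<in> sets \<Omega>"
    "\<forall>u\<in>V. \<forall>I J. I \<subseteq> V \<longrightarrow> J \<subseteq> V \<longrightarrow>
       {s \<in> space \<Omega>. \<forall>x\<in>space (PiM V S). s (u, impose x I) = s (u, impose x J)} \<in> sets \<Omega>"
    using suit unfolding suitable_sigma_algebras_def by - (elim conjE, assumption)+
  have "regular_law V S ?P"
    unfolding regular_law_def
  proof (intro ballI allI impI)
    fix u I J assume u: "u \<in> V" and I: "I \<subseteq> V" and J: "J \<subseteq> V"
      and ae: "\<forall>x\<in>space (PiM V S). AE s in ?P. s (u, impose x I) = s (u, impose x J)"
    show "AE s in ?P. \<forall>x\<in>space (PiM V S). s (u, impose x I) = s (u, impose x J)"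
    proof (rule AE_returnI[OF _ _ t])
      show "{s \<in> space \<Omega>. \<forall>x\<in>space (PiM V S). s (u, impose x I) = s (u, impose x J)} \<in> sets \<Omega>"
        using events(2) u I J by simp
      show "\<forall>x\<in>space (PiM V S). ?t (u, impose x I) = ?t (u, impose x J)"
        \<comment> \<open>Almost sure identities under the point mass hold at \<open>?t\<close>
          itself, so those for the single states combine without any null set.\<close>
        using ae AE_returnD[OF _ t] by blast
    qed
  qed
  then have "?P \<in> ground_model V S \<Omega>"
    using return_in_prob_algebra[OF t] consistent_edge_schedule[OF fin suit c v d wv]
    by (simp add: ground_model_def)
  moreover have "AE s in ?P. s (u, impose x I) = s (u, substitute s x I (parents {(w, v)} u))"
    if u: "u \<in> V" and I: "I \<subseteq> V" and x: "x \<in> space (PiM V S)" for u I x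
  proof (rule AE_returnI[OF _ _ t])
    show "{s \<in> space \<Omega>. s (u, impose x I) = s (u, substitute s x I (parents {(w, v)} u))} \<in> sets \<Omega>"
      using events(1) u I x par by simp
    have mx: "impose x I \<in> interventions V S" using impose_in_interventions[OF x I] .
    have "substitute ?t x I (parents {(w, v)} u) \<in> interventions V S"
      using substitute_eq_impose_state[OF t_cyl x I] impose_in_interventions par by metis
    then show "?t (u, impose x I) = ?t (u, substitute ?t x I (parents {(w, v)} u))"
      using u w mx wv
      by (auto simp: edge_schedule_apply substitute_eq_impose impose_def parents_def)
  qed
  moreover have "prob_space.indep_vars ?P S (\<lambda>u s. s (u, impose x (parents {(w, v)} u))) V"
    if "x \<in> space (PiM V S)" for x
    using that par
    by (intro indep_vars_return[OF t] measurable_outcome[OF suit] impose_in_interventions)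
  ultimately show ?thesis by (simp add: dag_model_def)
qed

text \<open>Imposing \<open>e\<close> on \<open>w\<close> moves \<open>v\<close> to
  \<open>d\<close>. The substituted intervention acts only on \<open>parents E v\<close>, which
  omits \<open>w\<close>, so it leaves \<open>v\<close> at \<open>c v\<close>, contradicting
  recursive substitution.\<close>

lemma return_edge_schedule_notin_dag_model:
  assumes suit: "suitable_sigma_algebras V S \<Omega>" and E: "E \<subseteq> V \<times> V"
    and c: "c \<in> space (PiM V S)" and w: "w \<in> V" and v: "v \<in> V" and d: "d \<in> space (S v)"
    and e: "e \<in> space (S w)" and ne: "d \<noteq> c v" "e \<noteq> c w" and edge: "(w, v) \<notin> E"
  shows "return \<Omega> (edge_schedule V S c w v d) \<notin> dag_model V S \<Omega> E"
proof
  let ?t = "edge_schedule V S c w v d"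
  let ?x = "c(w := e)"
  assume P: "return \<Omega> ?t \<in> dag_model V S \<Omega> E"
  have t: "?t \<in> space \<Omega>" using edge_schedule_in_space[OF suit c v d] .
  have t_cyl: "?t \<in> space (cylinder_space V S)"
    using suit t by (simp add: suitable_sigma_algebras_def)
  have x: "?x \<in> space (PiM V S)"
    using c e w by (auto simp: space_PiM PiE_iff extensional_def)
  have wV: "{w} \<subseteq> V" using w by simp
  have "AE s in return \<Omega> ?t. s (v, impose ?x {w}) = s (v, substitute s ?x {w} (parents E v))"
    using P v x wV unfolding dag_model_def by blast
  then have "?t (v, impose ?x {w}) = ?t (v, substitute ?t ?x {w} (parents E v))"
    using t by (rule AE_returnD)
  moreover have "substitute ?t ?x {w} (parents E v) \<in> interventions V S"
    using substitute_eq_impose_state[OF t_cyl x wV] impose_in_interventions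
      parents_subset[OF E] by metis
  ultimately show False
    using v ne edge impose_in_interventions[OF x wV]
    by (auto simp: edge_schedule_apply substitute_eq_impose impose_def parents_def)
qed

section \<open>Model inclusion is edge inclusion\<close>

lemma ex_other_element:
  assumes "infinite A \<or> card A \<ge> 2"
  shows "\<exists>b\<in>A. b \<noteq> a"
proof (rule ccontr)
  assume "\<not> ?thesis"
  then have "A \<subseteq> {a}" by blast
  then have "finite A" "card A \<le> 1"
    using finite_subset card_mono[of "{a}" A] by auto
  then show False using assms by auto
qed

lemma dag_le_iff_subset:
  assumes fin: "finite V"
    and two: "\<forall>v\<in>V. infinite (space (S v)) \<or> card (space (S v)) \<ge> 2"
    and suit: "suitable_sigma_algebras V S \<Omega>"
    and E: "E \<in> dags V" and E': "E' \<in> dags V"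
  shows "dag_le V S \<Omega> E E' \<longleftrightarrow> E \<subseteq> E'"
proof
  assume "E \<subseteq> E'"
  then show "dag_le V S \<Omega> E E'"
    using dag_model_mono[OF suit] E' by (auto simp: dag_le_def dags_def)
next
  assume le: "dag_le V S \<Omega> E E'"
  show "E \<subseteq> E'"
  proof (rule subrelI, rule ccontr)
    fix w v assume wv: "(w, v) \<in> E" and nwv: "(w, v) \<notin> E'"
    have V: "w \<in> V" "v \<in> V" and EV: "E \<subseteq> V \<times> V" "E' \<subseteq> V \<times> V"
      using wv E E' by (auto simp: dags_def)
    have ne: "w \<noteq> v" using wv E by (auto simp: dags_def acyclic_def)
    have other: "\<exists>b\<in>space (S u). b \<noteq> a" if "u \<in> V" for u a
      using two that by (intro ex_other_element) blast
    define c where "c = (\<lambda>u\<in>V. SOME a. a \<in> space (S u))"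
    have c: "c \<in> space (PiM V S)"
      using other by (auto simp: c_def space_PiM PiE_iff some_in_eq)
    \<comment> \<open>A second element in each of the two state spaces supplies the reaction
      \<open>d\<close> of \<open>v\<close> and the trigger \<open>e\<close> at
      \<open>w\<close>.\<close>
    obtain d e where d: "d \<in> space (S v)" "d \<noteq> c v" and e: "e \<in> space (S w)" "e \<noteq> c w"
      using other V by metis
    have "return \<Omega> (edge_schedule V S c w v d) \<in> dag_model V S \<Omega> {(w, v)}"
      using return_edge_schedule_in_dag_model[OF fin suit c V d(1) ne] .
    \<comment> \<open>Monotonicity reduces the edge of \<open>E\<close> to the graph with this
      single edge.\<close>
    also have "\<dots> \<subseteq> dag_model V S \<Omega> E"
      using wv EV by (intro dag_model_mono[OF suit]) auto
    also have "\<dots> \<subseteq> dag_model V S \<Omega> E'" using le by (simp add: dag_le_def)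
    finally show False
      using return_edge_schedule_notin_dag_model[OF suit EV(2) c V d(1) e(1) d(2) e(2) nwv]
      by blast
  qed
qed


section \<open>The distance\<close>

lemma covered_by_cong:
  assumes "\<And>x y. x \<in> G \<Longrightarrow> y \<in> G \<Longrightarrow> le x y = le' x y"
  shows "covered_by G le = covered_by G le'"
  using assms unfolding covered_by_def fun_eq_iff by blast

text \<open>Adding to \<open>A\<close> one element of \<open>B - A\<close> gives a set between them,
  which belongs to \<open>G\<close> by closure under subsets. Covering forces it to be
  \<open>B\<close>.\<close>

lemma covered_by_subset_iff:
  assumes down: "\<And>A B. A \<in> G \<Longrightarrow> B \<subseteq> A \<Longrightarrow> B \<in> G"
  shows "covered_by G (\<subseteq>) A B \<longleftrightarrow> B \<in> G \<and> (\<exists>e. e \<notin> A \<and> B = insert e A)"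
proof
  assume cov: "covered_by G (\<subseteq>) A B"
  then obtain e where e: "e \<in> B" "e \<notin> A" by (auto simp: covered_by_def)
  then have "insert e A \<in> G" using down[of B "insert e A"] cov by (auto simp: covered_by_def)
  then have "insert e A = B" using cov e by (auto simp: covered_by_def)
  then show "B \<in> G \<and> (\<exists>e. e \<notin> A \<and> B = insert e A)"
    using cov e by (auto simp: covered_by_def)
next
  assume "B \<in> G \<and> (\<exists>e. e \<notin> A \<and> B = insert e A)"
  then show "covered_by G (\<subseteq>) A B"
    using down[of B A] unfolding covered_by_def by blast
qed

lemma sym_relpow: "sym R \<Longrightarrow> sym (R ^^ n)"
proof (induction n)
  case (Suc n)
  then have "(R ^^ Suc n)\<inverse> = R O R ^^ n"
    by (simp add: converse_relcomp sym_conv_converse_eq)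
  then show ?case by (simp add: sym_conv_converse_eq relpow_commute)
qed (simp add: sym_Id)

text \<open>Each step adds or removes one element, which bounds the length from below. The path
  through \<open>A \<inter> B\<close> attains the bound.\<close>

lemma poset_dist_subset:
  assumes down: "\<And>A B. A \<in> G \<Longrightarrow> B \<subseteq> A \<Longrightarrow> B \<in> G"
    and fin: "\<And>A. A \<in> G \<Longrightarrow> finite A"
    and A: "A \<in> G" and B: "B \<in> G"
  shows "poset_dist G (\<subseteq>) A B = enat (card (sym_diff A B))"
proof -
  let ?R = "{(x, y). covered_by G (\<subseteq>) x y \<or> covered_by G (\<subseteq>) y x}"
  have cov: "covered_by G (\<subseteq>) C D \<longleftrightarrow> D \<in> G \<and> (\<exists>e. e \<notin> C \<and> D = insert e C)" for C D
    using down by (rule covered_by_subset_iff)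
  have lower: "card (sym_diff A C) \<le> n" if "(A, C) \<in> ?R ^^ n" for C n
    using that
  proof (induction n arbitrary: C)
    case (Suc n)
    then obtain D where D: "(A, D) \<in> ?R ^^ n" "(D, C) \<in> ?R" by auto
    then have "covered_by G (\<subseteq>) D C \<or> covered_by G (\<subseteq>) C D" by blast
    then have G: "D \<in> G" and "\<exists>e. C = insert e D \<or> D = insert e C"
      using cov down[of C D] by blast+
    \<comment> \<open>\<open>C\<close> and \<open>D\<close> differ only in \<open>e\<close>, so the
      symmetric difference with \<open>A\<close> gains at most \<open>e\<close>.\<close>
    then obtain e where e: "sym_diff A C \<subseteq> insert e (sym_diff A D)" by blast
    have finD: "finite (sym_diff A D)" using fin[OF A] fin[OF G] by simp
    then have "card (sym_diff A C) \<le> card (insert e (sym_diff A D))"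
      using e by (intro card_mono) auto
    also have "\<dots> \<le> Suc (card (sym_diff A D))" using finD by (simp add: card_insert_if)
    finally have "card (sym_diff A C) \<le> Suc (card (sym_diff A D))" .
    then show ?case using Suc.IH[OF D(1)] by simp
  qed auto
  \<comment> \<open>Elements of \<open>D - C\<close> are added one by one; all intermediate sets are
    subsets of \<open>D\<close> and hence in \<open>G\<close>.\<close>
  have up: "(C, D) \<in> ?R ^^ card (D - C)" if "C \<subseteq> D" "D \<in> G" for C D
    using fin[OF that(2)] that
  proof (induction "card (D - C)" arbitrary: D)
    case (Suc n)
    then obtain e where e: "e \<in> D - C" by (metis card_gt_0_iff ex_in_conv zero_less_Suc)
    have *: "D - {e} - C = D - C - {e}" by blast
    have "n = card (D - {e} - C)" using Suc.hyps(2) e Suc.prems(1) by (simp add: *)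
    then have "(C, D - {e}) \<in> ?R ^^ n"
      using Suc.hyps(1)[of "D - {e}"] Suc.prems e down[of D "D - {e}"] by auto
    moreover have "covered_by G (\<subseteq>) (D - {e}) D"
      unfolding cov using e Suc.prems by blast
    then have "(D - {e}, D) \<in> ?R" by simp
    ultimately have "(C, D) \<in> ?R ^^ Suc n" by (rule relpow_Suc_I)
    then show ?case using Suc.hyps(2) by simp
  qed auto
  have "sym ?R" by (auto simp: sym_def)
  have AB: "A - A \<inter> B = A - B" "B - A \<inter> B = B - A" by blast+
  have "(A \<inter> B, A) \<in> ?R ^^ card (A - B)"
    using up[of "A \<inter> B" A] A by (simp add: AB)
  \<comment> \<open>The step relation is symmetric, so the ascending path can be run
    downwards.\<close>
  then have "(A, A \<inter> B) \<in> ?R ^^ card (A - B)"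
    by (rule symD[OF sym_relpow[OF \<open>sym ?R\<close>]])
  moreover have "(A \<inter> B, B) \<in> ?R ^^ card (B - A)"
    using up[of "A \<inter> B" B] B by (simp add: AB)
  ultimately have "(A, B) \<in> ?R ^^ (card (A - B) + card (B - A))"
    unfolding relpow_add by (rule relcompI)
  also have "card (A - B) + card (B - A) = card (sym_diff A B)"
    using fin A B by (subst card_Un_disjoint) auto
  finally have upper: "(A, B) \<in> ?R ^^ card (sym_diff A B)" .
  show ?thesis
    unfolding poset_dist_def
  proof (rule antisym)
    show "(INF n\<in>{n. (A, B) \<in> ?R ^^ n}. enat n) \<le> enat (card (sym_diff A B))"
      using upper by (intro INF_lower) simp
    show "enat (card (sym_diff A B)) \<le> (INF n\<in>{n. (A, B) \<in> ?R ^^ n}. enat n)"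
      using lower by (intro INF_greatest) simp
  qed
qed

lemma dag_dist_eq:
  assumes fin: "finite V"
    and two: "\<forall>v\<in>V. infinite (space (S v)) \<or> card (space (S v)) \<ge> 2"
    and suit: "suitable_sigma_algebras V S \<Omega>"
    and E: "E1 \<in> dags V" "E2 \<in> dags V"
  shows "dag_dist V S \<Omega> E1 E2 = enat (card (sym_diff E1 E2))"
proof -
  have "covered_by (dags V) (dag_le V S \<Omega>) = covered_by (dags V) (\<subseteq>)"
    using dag_le_iff_subset[OF fin two suit] by (rule covered_by_cong)
  then have "dag_dist V S \<Omega> E1 E2 = poset_dist (dags V) (\<subseteq>) E1 E2"
    by (simp add: dag_dist_def poset_dist_def)
  also have "\<dots> = enat (card (sym_diff E1 E2))"
  proof (intro poset_dist_subset E)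
    show "B \<in> dags V" if "A \<in> dags V" "B \<subseteq> A" for A B
      using that acyclic_subset by (auto simp: dags_def)
    show "finite A" if "A \<in> dags V" for A
      using that fin finite_subset[of A "V \<times> V"] by (simp add: dags_def)
  qed
  finally show ?thesis .
qed

section \<open>Comparison with the structural Hamming distances\<close>

lemma SHD2_eq_card:
  assumes "finite V" "E1 \<subseteq> V \<times> V" "E2 \<subseteq> V \<times> V"
  shows "SHD2 V E1 E2 = card (sym_diff E1 E2)"
proof -
  have "SHD2 V E1 E2 = (\<Sum>p\<in>V \<times> V. of_bool (p \<in> sym_diff E1 E2))"
    unfolding SHD2_def by (intro sum.cong) (auto simp: adj_def)
  also have "\<dots> = card ((V \<times> V) \<inter> sym_diff E1 E2)"
    using assms(1) by (simp only: sum_of_bool_eq Collect_mem_eq of_nat_id finite_cartesian_product)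
  also have "(V \<times> V) \<inter> sym_diff E1 E2 = sym_diff E1 E2" using assms by auto
  finally show ?thesis .
qed

text \<open>\<open>orient\<close> lists the ends of an edge in increasing order and so forgets its
  direction. Each pair counted by \<open>SHD1\<close> is the image of a differing edge; opposite
  edges share one image, which later gives strictness.\<close>

lemma SHD1_le_card:
  fixes V :: "'v::linorder set"
  assumes "finite V"
  defines "orient \<equiv> (\<lambda>(i, j). if i < j then (i, j) else (j, i))"
  assumes E: "E1 \<subseteq> V \<times> V" "E2 \<subseteq> V \<times> V"
  shows "SHD1 V E1 E2 \<le> card (orient ` sym_diff E1 E2)"
proof -
  let ?T = "{(i, j). i \<in> V \<and> j \<in> V \<and> i < j}"
  let ?Q = "{(i, j). i < j \<and> ((i, j) \<in> sym_diff E1 E2 \<or> (j, i) \<in> sym_diff E1 E2)}"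
  have finT: "finite ?T" using assms(1) by (auto intro: finite_subset[of _ "V \<times> V"])
  have "SHD1 V E1 E2 = (\<Sum>p\<in>?T. of_bool (p \<in> ?Q))"
    unfolding SHD1_def by (intro sum.cong) (auto simp: adj_def split: if_splits)
  also have "\<dots> = card (?T \<inter> ?Q)"
    using finT by (simp only: sum_of_bool_eq Collect_mem_eq of_nat_id)
  also have "\<dots> \<le> card (orient ` sym_diff E1 E2)"
  proof (rule card_mono)
    show "finite (orient ` sym_diff E1 E2)"
      using assms(1) E finite_subset[of "sym_diff E1 E2" "V \<times> V"] by fastforce
    show "?T \<inter> ?Q \<subseteq> orient ` sym_diff E1 E2"
    proof
      fix p assume "p \<in> ?T \<inter> ?Q"
      then obtain i j where p: "p = (i, j)" "i < j"
        and "(i, j) \<in> sym_diff E1 E2 \<or> (j, i) \<in> sym_diff E1 E2" by blast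
      moreover have "p = orient (i, j)" "p = orient (j, i)"
        using p by (auto simp: orient_def)
      ultimately show "p \<in> orient ` sym_diff E1 E2" by blast
    qed
  qed
  finally show ?thesis .
qed

lemma acyclic_not_converse: "acyclic E \<Longrightarrow> (i, j) \<in> E \<Longrightarrow> (j, i) \<notin> E"
  by (meson acyclic_def r_into_trancl trancl_into_trancl)

theorem corollary3:
  fixes V :: "'v::linorder set"
    and S :: "'v \<Rightarrow> 'a measure"
    and \<Omega> :: "('v, 'a) schedule measure"
    and E1 E2 :: "'v rel"
  assumes "finite V"
    and "\<forall>v\<in>V. infinite (space (S v)) \<or> card (space (S v)) \<ge> 2"
    and "suitable_sigma_algebras V S \<Omega>"
    and "E1 \<in> dags V" and "E2 \<in> dags V"
  shows "dag_dist V S \<Omega> E1 E2 = enat (card (sym_diff E1 E2))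
    \<and> card (sym_diff E1 E2) = SHD2 V E1 E2
    \<and> dag_dist V S \<Omega> E1 E2 \<ge> enat (SHD1 V E1 E2)
    \<and> ((\<exists>i j. (i, j) \<in> E1 \<and> (j, i) \<in> E2) \<longrightarrow> dag_dist V S \<Omega> E1 E2 > enat (SHD1 V E1 E2))"
proof -
  let ?D = "sym_diff E1 E2"
  let ?orient = "\<lambda>(i, j). if i < j then (i, j) else (j, i :: 'v)"
  have E: "E1 \<subseteq> V \<times> V" "E2 \<subseteq> V \<times> V" "acyclic E1" "acyclic E2"
    using assms(4,5) by (auto simp: dags_def)
  have finD: "finite ?D"
    using assms(1) E finite_subset[of ?D "V \<times> V"] by fastforce
  note le = SHD1_le_card[OF assms(1) E(1,2)]
  have "SHD1 V E1 E2 \<le> card ?D"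
    using le card_image_le[OF finD, of ?orient] by linarith
  moreover have "SHD1 V E1 E2 < card ?D" if ij: "(i, j) \<in> E1" "(j, i) \<in> E2" for i j
  proof -
    \<comment> \<open>Neither DAG contains both directions, so a reversed edge contributes two
      elements to the symmetric difference.\<close>
    have "(j, i) \<notin> E1" "(i, j) \<notin> E2"
      using acyclic_not_converse[OF E(3) ij(1)] acyclic_not_converse[OF E(4) ij(2)] .
    then have D: "(i, j) \<in> ?D" "(j, i) \<in> ?D" and "i \<noteq> j"
      using ij by auto
    \<comment> \<open>These two elements collapse under \<open>?orient\<close>, so the image is
      strictly smaller than \<open>?D\<close>.\<close>
    then have "(i, j) \<noteq> (j, i)" "?orient (i, j) = ?orient (j, i)" by auto
    then have "\<not> inj_on ?orient ?D" using inj_onD[OF _ _ D] by blast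
    then have "card (?orient ` ?D) \<noteq> card ?D"
      using eq_card_imp_inj_on[OF finD] by blast
    then have "card (?orient ` ?D) < card ?D"
      using card_image_le[OF finD, of ?orient] by linarith
    then show ?thesis using le by linarith
  qed
  ultimately show ?thesis
    using dag_dist_eq[OF assms] SHD2_eq_card[OF assms(1) E(1,2)] by auto
qed

end
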